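(* Let $\mathcal{M}$ be the following infinitely branching MDP. There is a controlled state $s$, a controlled state $t$, and random states $r_i$ for $i\ge 1$. The successors of $s$ are all $r_i$ ($i\ge1$), with reward $0$. From $r_i$ the MDP moves to $t$ with probability $2^{-i}$ (reward $-1$) and to $s$ with probability $1-2^{-i}$ (reward $0$). The only successor of $t$ is $s$, with reward $+1$. (Thus the total reward accumulated from $s$ is determined by the current state: $0$ at $s$ and at each $r_i$, $-1$ at $t$.) Consider the objective $\mathit{PP}_{\liminf\ge 0}=\{\rho\mid \liminf_{n\to\infty} r(e_n)\ge 0\}$. Then (1) every finite-memory randomized (FR) strategy $\sigma$ satisfies $\mathcal{P}_{\mathcal{M},s,\sigma}(\mathit{PP}_{\liminf\ge 0})=0$; (2) there exists a history-dependent deterministic (HD) strategy $\sigma$ with $\mathcal{P}_{\mathcal{M},s,\sigma}(\mathit{PP}_{\liminf\ge 0})=1$. Hence optimal (and even almost-surely winning) strategies and $\varepsilon$-optimal strategies for $\mathit{PP}_{\liminf\ge 0}$ require infinite memory beyond a reward counter.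
   Context: In an MDP, a strategy assigns to each finite partial run ending in a controlled state a probability distribution over that state's successors; random states move according to fixed distributions; an initial state and strategy induce a probability measure $\mathcal{P}_{\mathcal{M},s,\sigma}$ on runs $s_0e_0s_1e_1\dots$ where $e_n$ are transitions and $r(e_n)$ their rewards. A strategy is finite-memory randomized (FR) if it can be implemented with a finite set of memory modes, an initial mode, and a (possibly randomized) function mapping the current mode and state to a distribution over pairs (next mode, successor state), consistent with the fixed distributions at random states. HD strategies are arbitrary history-dependent strategies whose choices are Dirac distributions. A reward counter strategy is one whose memory records only the sum of all transition rewards seen so far. Almost-surely winning means winning with probability $1$; $\varepsilon$-optimal means attaining at least the supremum over strategies minus $\varepsilon$. *)

theory Defs
  imports "HOL-Probability.Probability" "HOL-Analysis.Infinite_Set_Sum"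
begin

section \<open>Markov decision processes\<close>

text \<open>
  There is at most one transition between two states, so a transition is the pair of its endpoints
  and a run \<open>s\<^sub>0 e\<^sub>0 s\<^sub>1 e\<^sub>1 \<dots>\<close> is determined by its states: \<open>e\<^sub>n = (s\<^sub>n, s\<^sub>n\<^sub>+\<^sub>1)\<close>.
  The states outside \<open>controlled\<close> are the random ones; \<open>trans_prob\<close> is meaningful only there.
\<close>

record 's mdp =
  controlled :: "'s set"
  transitions :: "('s \<times> 's) set"
  trans_prob :: "'s \<Rightarrow> 's pmf"
  reward :: "'s \<times> 's \<Rightarrow> real"

definition well_formed :: "'s mdp \<Rightarrow> bool" where
  "well_formed M \<longleftrightarrow>
     (\<forall>s. transitions M `` {s} \<noteq> {}) \<and>
     (\<forall>s. s \<notin> controlled M \<longrightarrow> set_pmf (trans_prob M s) = transitions M `` {s})"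

definition partial_run :: "'s mdp \<Rightarrow> 's list \<Rightarrow> bool" where
  "partial_run M \<rho> \<longleftrightarrow> \<rho> \<noteq> [] \<and> successively (\<lambda>s s'. (s, s') \<in> transitions M) \<rho>"

definition total_reward :: "'s mdp \<Rightarrow> 's list \<Rightarrow> real" where
  "total_reward M \<rho> = (\<Sum>i < length \<rho> - 1. reward M (\<rho> ! i, \<rho> ! Suc i))"

section \<open>Strategies and the induced probability measure on runs\<close>

text \<open>Only the values of \<open>\<sigma>\<close> at partial runs ending in a controlled state matter.\<close>

definition strategy :: "'s mdp \<Rightarrow> ('s list \<Rightarrow> 's pmf) \<Rightarrow> bool" where
  "strategy M \<sigma> \<longleftrightarrow>
     (\<forall>\<rho>. partial_run M \<rho> \<and> last \<rho> \<in> controlled M \<longrightarrow>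
        set_pmf (\<sigma> \<rho>) \<subseteq> transitions M `` {last \<rho>})"

definition HD_strategy :: "'s mdp \<Rightarrow> ('s list \<Rightarrow> 's pmf) \<Rightarrow> bool" where
  "HD_strategy M \<sigma> \<longleftrightarrow>
     strategy M \<sigma> \<and>
     (\<forall>\<rho>. partial_run M \<rho> \<and> last \<rho> \<in> controlled M \<longrightarrow> (\<exists>s'. \<sigma> \<rho> = return_pmf s'))"

definition next_state :: "'s mdp \<Rightarrow> ('s list \<Rightarrow> 's pmf) \<Rightarrow> 's list \<Rightarrow> 's pmf" where
  "next_state M \<sigma> \<rho> = (if last \<rho> \<in> controlled M then \<sigma> \<rho> else trans_prob M (last \<rho>))"

definition run_kernel ::
    "'s mdp \<Rightarrow> 's \<Rightarrow> ('s list \<Rightarrow> 's pmf) \<Rightarrow> nat \<Rightarrow> (nat \<Rightarrow> 's) \<Rightarrow> 's measure" where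
  "run_kernel M s0 \<sigma> n \<omega> =
     measure_pmf (if n = 0 then return_pmf s0 else next_state M \<sigma> (map \<omega> [0..<n]))"

text \<open>
  The measure given by the Ionescu-Tulcea theorem. Inside \<^locale>\<open>Ionescu_Tulcea\<close> it is called
  \<open>PF.lim\<close>; the assumptions of that locale are established below.
\<close>

definition run_measure ::
    "('s::countable) mdp \<Rightarrow> 's \<Rightarrow> ('s list \<Rightarrow> 's pmf) \<Rightarrow> (nat \<Rightarrow> 's) measure" where
  "run_measure M s0 \<sigma> =
     projective_family.lim UNIV
       (Ionescu_Tulcea.CI (run_kernel M s0 \<sigma>) (\<lambda>_. count_space UNIV)) (\<lambda>_. count_space UNIV)"

lemma Ionescu_Tulcea_run_kernel:
  fixes M :: "('s::countable) mdp"
  shows "Ionescu_Tulcea (run_kernel M s0 \<sigma>) (\<lambda>_. count_space UNIV)"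
proof (rule Ionescu_Tulcea.intro)
  fix i :: nat
  have "PiM {0..<i} (\<lambda>_. count_space (UNIV :: 's set)) = count_space (PiE {0..<i} (\<lambda>_. UNIV))"
    by (rule count_space_PiM_finite) auto
  then show "run_kernel M s0 \<sigma> i \<in>
      measurable (PiM {0..<i} (\<lambda>_. count_space UNIV)) (subprob_algebra (count_space UNIV))"
    by (simp add: run_kernel_def[abs_def] measure_pmf_in_subprob_algebra)
next
  fix i :: nat and x :: "nat \<Rightarrow> 's"
  show "prob_space (run_kernel M s0 \<sigma> i x)"
    unfolding run_kernel_def by (rule prob_space_measure_pmf)
qed

lemma sets_run_measure:
  "sets (run_measure M s0 \<sigma>) = sets (PiM UNIV (\<lambda>_. count_space UNIV))"
proof -
  interpret Ionescu_Tulcea "run_kernel M s0 \<sigma>" "\<lambda>_. count_space UNIV"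
    by (rule Ionescu_Tulcea_run_kernel)
  show ?thesis
    unfolding run_measure_def by (rule PF.sets_lim)
qed

lemma space_run_measure: "space (run_measure M s0 \<sigma>) = UNIV"
  using sets_eq_imp_space_eq[OF sets_run_measure[of M s0 \<sigma>]] by (simp add: space_PiM)

lemma prob_space_run_measure: "prob_space (run_measure M s0 \<sigma>)"
proof -
  interpret Ionescu_Tulcea "run_kernel M s0 \<sigma>" "\<lambda>_. count_space UNIV"
    by (rule Ionescu_Tulcea_run_kernel)
  have "emeasure PF.lim (PF.emb UNIV {} {\<lambda>_. undefined}) = emeasure (CI {}) {\<lambda>_. undefined}"
    by (rule lim) (auto simp: PiM_empty)
  also have "\<dots> = 1"
    using prob_space.emeasure_space_1[OF PF.prob_space_P[of "{}"]] PF.space_P[of "{}"]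
    by (simp add: PiM_empty space_PiM)
  finally have "emeasure (run_measure M s0 \<sigma>) UNIV = 1"
    by (simp add: run_measure_def prod_emb_def restrict_def)
  then show ?thesis
    by (intro prob_spaceI) (simp add: space_run_measure)
qed

section \<open>Objectives and optimality\<close>

definition PP_liminf_ge_0 :: "'s mdp \<Rightarrow> (nat \<Rightarrow> 's) set" where
  "PP_liminf_ge_0 M = {\<omega>. 0 \<le> liminf (\<lambda>n. ereal (reward M (\<omega> n, \<omega> (Suc n))))}"

lemma PP_liminf_ge_0_in_sets:
  fixes M :: "('s::countable) mdp"
  shows "PP_liminf_ge_0 M \<in> sets (run_measure M s0 \<sigma>)"
proof -
  have r: "(\<lambda>\<omega>. ereal (reward M (\<omega> n, \<omega> (Suc n)))) \<in>
      borel_measurable (PiM UNIV (\<lambda>_. count_space (UNIV :: 's set)))" for n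
  proof -
    have "(\<lambda>\<omega>. (\<omega> n, \<omega> (Suc n))) \<in>
        measurable (PiM UNIV (\<lambda>_. count_space (UNIV :: 's set))) (count_space UNIV \<Otimes>\<^sub>M count_space UNIV)"
      by measurable
    also have "count_space (UNIV :: 's set) \<Otimes>\<^sub>M count_space (UNIV :: 's set) = count_space UNIV"
      by (subst pair_measure_countable) auto
    finally show ?thesis
      by (rule measurable_compose) simp
  qed
  have "{\<omega> \<in> space (PiM UNIV (\<lambda>_. count_space (UNIV :: 's set))).
      0 \<le> liminf (\<lambda>n. ereal (reward M (\<omega> n, \<omega> (Suc n))))} \<in>
      sets (PiM UNIV (\<lambda>_. count_space (UNIV :: 's set)))"
    using r by measurable
  then show ?thesis
    by (simp add: sets_run_measure PP_liminf_ge_0_def space_PiM)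
qed

definition attainment ::
    "('s::countable) mdp \<Rightarrow> 's \<Rightarrow> (nat \<Rightarrow> 's) set \<Rightarrow> ('s list \<Rightarrow> 's pmf) \<Rightarrow> real" where
  "attainment M s0 Obj \<sigma> = measure (run_measure M s0 \<sigma>) Obj"

definition mdp_value :: "('s::countable) mdp \<Rightarrow> 's \<Rightarrow> (nat \<Rightarrow> 's) set \<Rightarrow> real" where
  "mdp_value M s0 Obj = (SUP \<sigma>\<in>{\<sigma>. strategy M \<sigma>}. attainment M s0 Obj \<sigma>)"

definition almost_surely_winning ::
    "('s::countable) mdp \<Rightarrow> 's \<Rightarrow> (nat \<Rightarrow> 's) set \<Rightarrow> ('s list \<Rightarrow> 's pmf) \<Rightarrow> bool" where
  "almost_surely_winning M s0 Obj \<sigma> \<longleftrightarrow> strategy M \<sigma> \<and> attainment M s0 Obj \<sigma> = 1"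

definition eps_optimal ::
    "('s::countable) mdp \<Rightarrow> 's \<Rightarrow> (nat \<Rightarrow> 's) set \<Rightarrow> real \<Rightarrow> ('s list \<Rightarrow> 's pmf) \<Rightarrow> bool" where
  "eps_optimal M s0 Obj \<epsilon> \<sigma> \<longleftrightarrow> strategy M \<sigma> \<and> attainment M s0 Obj \<sigma> \<ge> mdp_value M s0 Obj - \<epsilon>"

definition optimal ::
    "('s::countable) mdp \<Rightarrow> 's \<Rightarrow> (nat \<Rightarrow> 's) set \<Rightarrow> ('s list \<Rightarrow> 's pmf) \<Rightarrow> bool" where
  "optimal M s0 Obj \<sigma> \<longleftrightarrow> strategy M \<sigma> \<and> attainment M s0 Obj \<sigma> = mdp_value M s0 Obj"

section \<open>Strategies with memory\<close>

definition memory_function ::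
    "'s mdp \<Rightarrow> 'm set \<Rightarrow> ('m \<Rightarrow> 's \<Rightarrow> ('m \<times> 's) pmf) \<Rightarrow> bool" where
  "memory_function M Q \<tau> \<longleftrightarrow>
     (\<forall>m\<in>Q. \<forall>s. set_pmf (\<tau> m s) \<subseteq> Q \<times> transitions M `` {s} \<and>
        (s \<notin> controlled M \<longrightarrow> map_pmf snd (\<tau> m s) = trans_prob M s))"

text \<open>The first \<open>n + 1\<close> states of the Markov chain on modes and states with kernel \<open>\<tau>\<close>.\<close>

primrec chain_prefix ::
    "('m \<Rightarrow> 's \<Rightarrow> ('m \<times> 's) pmf) \<Rightarrow> 'm \<Rightarrow> 's \<Rightarrow> nat \<Rightarrow> ('m \<times> 's) list pmf" where
  "chain_prefix \<tau> m0 s0 0 = return_pmf [(m0, s0)]"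
| "chain_prefix \<tau> m0 s0 (Suc n) =
     bind_pmf (chain_prefix \<tau> m0 s0 n)
       (\<lambda>h. map_pmf (\<lambda>x. h @ [x]) (\<tau> (fst (last h)) (snd (last h))))"

definition lifts :: "'s list \<Rightarrow> ('m \<times> 's) list set" where
  "lifts \<rho> = {h. map snd h = \<rho>}"

text \<open>
  The distribution of the current mode conditioned on the observed partial run \<open>\<rho>\<close>; it is
  meaningful only if \<open>\<rho>\<close> has positive probability in the chain.
\<close>

definition mode_dist ::
    "('m \<Rightarrow> 's \<Rightarrow> ('m \<times> 's) pmf) \<Rightarrow> 'm \<Rightarrow> 's \<Rightarrow> 's list \<Rightarrow> 'm pmf" where
  "mode_dist \<tau> m0 s0 \<rho> =
     map_pmf (\<lambda>h. fst (last h)) (cond_pmf (chain_prefix \<tau> m0 s0 (length \<rho> - 1)) (lifts \<rho>))"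

definition induced_choice ::
    "('m \<Rightarrow> 's \<Rightarrow> ('m \<times> 's) pmf) \<Rightarrow> 'm \<Rightarrow> 's \<Rightarrow> 's list \<Rightarrow> 's pmf" where
  "induced_choice \<tau> m0 s0 \<rho> =
     bind_pmf (mode_dist \<tau> m0 s0 \<rho>) (\<lambda>m. map_pmf snd (\<tau> m (last \<rho>)))"

text \<open>
  The values of \<open>\<sigma>\<close> at partial runs that have probability 0 in the chain are unconstrained, since
  the conditional distribution does not exist there.
\<close>

definition implemented_by ::
    "'s mdp \<Rightarrow> 's \<Rightarrow> ('s list \<Rightarrow> 's pmf) \<Rightarrow> 'm set \<Rightarrow> ('m \<Rightarrow> 's \<Rightarrow> ('m \<times> 's) pmf) \<Rightarrow> 'm \<Rightarrow> bool" where
  "implemented_by M s0 \<sigma> Q \<tau> m0 \<longleftrightarrow>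
     memory_function M Q \<tau> \<and> m0 \<in> Q \<and>
     (\<forall>\<rho>. last \<rho> \<in> controlled M \<and>
          set_pmf (chain_prefix \<tau> m0 s0 (length \<rho> - 1)) \<inter> lifts \<rho> \<noteq> {} \<longrightarrow>
        \<sigma> \<rho> = induced_choice \<tau> m0 s0 \<rho>)"

text \<open>Every finite set of modes can be renamed to a set of natural numbers.\<close>

definition FR_strategy :: "'s mdp \<Rightarrow> 's \<Rightarrow> ('s list \<Rightarrow> 's pmf) \<Rightarrow> bool" where
  "FR_strategy M s0 \<sigma> \<longleftrightarrow>
     strategy M \<sigma> \<and> (\<exists>(Q :: nat set) \<tau> q0. finite Q \<and> implemented_by M s0 \<sigma> Q \<tau> q0)"

text \<open>
  Modes are pairs of a finite-memory mode and a counter holding the sum of the rewards seen so far;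
  both components may be used for the choices. A reward counter strategy without further memory
  is the case of a one-element \<open>Q\<close>.
\<close>

definition counts_reward ::
    "'s mdp \<Rightarrow> 'q set \<Rightarrow> ('q \<times> real \<Rightarrow> 's \<Rightarrow> (('q \<times> real) \<times> 's) pmf) \<Rightarrow> bool" where
  "counts_reward M Q \<tau> \<longleftrightarrow>
     (\<forall>q\<in>Q. \<forall>c s q' c' s'. ((q', c'), s') \<in> set_pmf (\<tau> (q, c) s) \<longrightarrow> c' = c + reward M (s, s'))"

definition reward_counter_FR_strategy :: "'s mdp \<Rightarrow> 's \<Rightarrow> ('s list \<Rightarrow> 's pmf) \<Rightarrow> bool" where
  "reward_counter_FR_strategy M s0 \<sigma> \<longleftrightarrow>
     strategy M \<sigma> \<and>
     (\<exists>(Q :: nat set) \<tau> q0. finite Q \<and> counts_reward M Q \<tau> \<and>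
        implemented_by M s0 \<sigma> (Q \<times> (UNIV :: real set)) \<tau> (q0, 0))"

section \<open>The infinitely branching MDP\<close>

text \<open>\<open>St_r i\<close> stands for the random state \<open>r\<^sub>i\<^sub>+\<^sub>1\<close>, so that the indices start at 1.\<close>

datatype vertex = St_s | St_t | St_r nat

instance vertex :: countable
  by countable_datatype

definition inf_branching_mdp :: "vertex mdp" where
  "inf_branching_mdp = \<lparr>
     controlled = {St_s, St_t},
     transitions = (\<Union>i. {(St_s, St_r i), (St_r i, St_t), (St_r i, St_s)}) \<union> {(St_t, St_s)},
     trans_prob = (\<lambda>v. case v of
         St_r i \<Rightarrow> map_pmf (\<lambda>b. if b then St_t else St_s) (bernoulli_pmf ((1 / 2) ^ Suc i))
       | _ \<Rightarrow> undefined),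
     reward = (\<lambda>e. case e of
         (St_r i, St_t) \<Rightarrow> - 1
       | (St_t, St_s) \<Rightarrow> 1
       | _ \<Rightarrow> 0) \<rparr>"

lemma well_formed_inf_branching_mdp: "well_formed inf_branching_mdp"
  unfolding well_formed_def
proof (intro conjI allI impI)
  fix v
  show "transitions inf_branching_mdp `` {v} \<noteq> {}"
    by (cases v) (auto simp: inf_branching_mdp_def Image_def)
  assume "v \<notin> controlled inf_branching_mdp"
  then obtain i where v: "v = St_r i"
    by (cases v) (auto simp: inf_branching_mdp_def)
  have "(1 / 2 :: real) ^ Suc i < 1"
    by (rule power_Suc_less_one) auto
  then have "set_pmf (bernoulli_pmf ((1 / 2) ^ Suc i)) = UNIV"
    by (intro set_pmf_bernoulli) auto
  then show "set_pmf (trans_prob inf_branching_mdp v) = transitions inf_branching_mdp `` {v}"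
    by (auto simp: v inf_branching_mdp_def Image_def UNIV_bool simp del: power_Suc)
qed

end

theory Submission
  imports Defs
begin

text \<open>
  A run wins iff it visits \<open>t\<close> only finitely often. If only finitely many modes can occur at \<open>s\<close>,
  then the one-step choices made there have probabilities of moving on to \<open>t\<close> that are bounded
  below by a positive constant, since the choice observed after a partial run is a mixture of the
  choices of the individual modes. Hence from every reachable partial run \<open>t\<close> is visited within three
  steps with at least this probability, and almost surely \<open>t\<close> is visited infinitely often. A reward
  counter adds nothing, as its value at \<open>s\<close> is always 0. Conversely, choosing after a partial run
  of length \<open>n\<close> at \<open>s\<close> a random state that moves to \<open>t\<close> with probability of order \<open>2\<^sup>-\<^sup>n\<close> wins
  almost surely by the Borel-Cantelli lemma.
\<close>

section \<open>The law of the finite prefixes of a run\<close>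

text \<open>
  Here \<open>n\<close> counts states, whereas the argument of \<^const>\<open>chain_prefix\<close> counts transitions.
\<close>

primrec prefix_pmf :: "'s mdp \<Rightarrow> 's \<Rightarrow> ('s list \<Rightarrow> 's pmf) \<Rightarrow> nat \<Rightarrow> 's list pmf" where
  "prefix_pmf M s0 \<sigma> 0 = return_pmf []"
| "prefix_pmf M s0 \<sigma> (Suc n) =
     bind_pmf (prefix_pmf M s0 \<sigma> n)
       (\<lambda>\<rho>. map_pmf (\<lambda>x. \<rho> @ [x]) (if \<rho> = [] then return_pmf s0 else next_state M \<sigma> \<rho>))"

text \<open>\<open>C 0 n\<close> composes the first \<open>n\<close> kernels of the Ionescu-Tulcea
  construction. Quantifying over all integrands lets the induction integrate out the last state and
  apply the hypothesis to the resulting function of the shorter prefix.\<close>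

lemma nn_integral_C_run_kernel:
  fixes M :: "('s::countable) mdp" and f :: "'s list \<Rightarrow> ennreal"
  shows "(\<integral>\<^sup>+\<omega>. f (map \<omega> [0..<n])
      \<partial>Ionescu_Tulcea.C (run_kernel M s0 \<sigma>) (\<lambda>_. count_space UNIV) 0 n (\<lambda>_. undefined)) =
    (\<integral>\<^sup>+\<rho>. f \<rho> \<partial>prefix_pmf M s0 \<sigma> n)"
proof (induction n arbitrary: f)
  interpret Ionescu_Tulcea "run_kernel M s0 \<sigma>" "\<lambda>_. count_space UNIV"
    by (rule Ionescu_Tulcea_run_kernel)
  \<comment> \<open>A finite product of countable discrete spaces is discrete, so every function on
    it is measurable.\<close>
  have meas: "g \<in> borel_measurable (PiM {0..<n} (\<lambda>_. count_space UNIV))"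
    for g :: "(nat \<Rightarrow> 's) \<Rightarrow> ennreal" and n
    by (subst count_space_PiM_finite) auto
  {
    case 0
    show ?case
      by (simp add: nn_integral_return space_PiM PiM_empty)
  next
    case (Suc n)
    have "(\<integral>\<^sup>+\<omega>. f (map \<omega> [0..<Suc n]) \<partial>C 0 (Suc n) (\<lambda>_. undefined)) =
        (\<integral>\<^sup>+\<omega>. \<integral>\<^sup>+\<omega>'. f (map \<omega>' [0..<Suc n]) \<partial>eP n \<omega> \<partial>C 0 n (\<lambda>_. undefined))"
      by (simp del: upt_Suc)
        (subst nn_integral_bind[where B="PiM {0..<Suc n} (\<lambda>_. count_space UNIV)"],
          auto simp: measurable_cong_sets[OF sets_C refl] space_PiM intro!: meas)
    also have "\<dots> = (\<integral>\<^sup>+\<omega>. \<integral>\<^sup>+x. f (map (fun_upd \<omega> n x) [0..<Suc n]) \<partial>run_kernel M s0 \<sigma> n \<omega>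
        \<partial>C 0 n (\<lambda>_. undefined))"
      by (intro nn_integral_cong nn_integral_eP meas) (simp add: space_C space_PiM)
    \<comment> \<open>The inner integral is rewritten as a function of the list of the first
      \<open>n\<close> states, the form to which the induction hypothesis applies.\<close>
    also have "\<dots> = (\<integral>\<^sup>+\<omega>. (\<lambda>\<rho>. \<integral>\<^sup>+x. f (\<rho> @ [x])
        \<partial>(if \<rho> = [] then return_pmf s0 else next_state M \<sigma> \<rho>)) (map \<omega> [0..<n])
        \<partial>C 0 n (\<lambda>_. undefined))"
      by (intro nn_integral_cong) (auto simp: run_kernel_def intro!: nn_integral_cong arg_cong[of _ _ f])
    also have "\<dots> = (\<integral>\<^sup>+\<rho>. f \<rho> \<partial>prefix_pmf M s0 \<sigma> (Suc n))"
      by (subst Suc.IH) simp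
    finally show ?case .
  }
qed

lemma sets_run_measure_prefix:
  fixes M :: "('s::countable) mdp"
  shows "{\<omega>. P (map \<omega> [0..<n])} \<in> sets (run_measure M s0 \<sigma>)"
proof -
  have "(\<lambda>\<omega>. map \<omega> [0..<n]) \<in>
      measurable (PiM UNIV (\<lambda>_. count_space (UNIV :: 's set))) (count_space UNIV)"
  proof (induction n)
    case (Suc n)
    have "(\<lambda>(\<rho>, x). \<rho> @ [x]) \<in> measurable
        (count_space (UNIV :: 's list set) \<Otimes>\<^sub>M count_space (UNIV :: 's set)) (count_space UNIV)"
      by (subst pair_measure_countable) auto
    from measurable_compose[OF measurable_Pair[OF Suc measurable_component_singleton[of n]] this]
    show ?case by simp
  qed simp
  from measurable_sets[OF this, of "{\<rho>. P \<rho>}"] show ?thesis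
    by (simp add: sets_run_measure vimage_def space_PiM)
qed

text \<open>The event is a cylinder over the coordinates below \<open>n\<close>, and on cylinders
  the limit measure agrees with the finite composition of kernels.\<close>

lemma emeasure_run_measure_prefix:
  fixes M :: "('s::countable) mdp"
  shows "emeasure (run_measure M s0 \<sigma>) {\<omega>. P (map \<omega> [0..<n])} =
    emeasure (prefix_pmf M s0 \<sigma> n) {\<rho>. P \<rho>}"
proof -
  interpret Ionescu_Tulcea "run_kernel M s0 \<sigma>" "\<lambda>_. count_space UNIV"
    by (rule Ionescu_Tulcea_run_kernel)
  let ?S = "\<lambda>_. count_space UNIV :: 's measure"
  define X where "X = {\<omega> \<in> space (PiM {0..<n} ?S). P (map \<omega> [0..<n])}"
  have X: "X \<in> sets (PiM {0..<n} ?S)"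
    by (subst count_space_PiM_finite) (auto simp: X_def space_PiM)
  have "map (restrict \<omega> {0..<n}) [0..<n] = map \<omega> [0..<n]" for \<omega> :: "nat \<Rightarrow> 's"
    by auto
  then have "{\<omega>. P (map \<omega> [0..<n])} = PF.emb UNIV {0..<n} X"
    by (auto simp: X_def prod_emb_def space_PiM simp del: restrict_apply map_eq_conv)
  then have "emeasure (run_measure M s0 \<sigma>) {\<omega>. P (map \<omega> [0..<n])} =
      emeasure (C 0 n (\<lambda>_. undefined)) X"
    using X emeasure_CI[of "{0..<n}" n X] sets.sets_into_space[OF X]
    by (simp add: run_measure_def lim prod_emb_id space_PiM)
  also have "\<dots> = (\<integral>\<^sup>+\<omega>. indicator X \<omega> \<partial>C 0 n (\<lambda>_. undefined))"
    using X by (simp add: sets_C space_PiM)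
  also have "\<dots> = (\<integral>\<^sup>+\<omega>. indicator {\<rho>. P \<rho>} (map \<omega> [0..<n]) \<partial>C 0 n (\<lambda>_. undefined))"
    by (intro nn_integral_cong) (auto simp: space_C X_def split: split_indicator)
  also have "\<dots> = emeasure (prefix_pmf M s0 \<sigma> n) {\<rho>. P \<rho>}"
    by (subst nn_integral_C_run_kernel) simp
  finally show ?thesis .
qed

text \<open>There is one null event per length, hence countably many, so facts about the supports of
  the prefix laws hold at all lengths at once along almost every run.\<close>

lemma AE_run_measure_prefix:
  fixes M :: "('s::countable) mdp"
  assumes "\<And>n \<rho>. \<rho> \<in> set_pmf (prefix_pmf M s0 \<sigma> n) \<Longrightarrow> P n \<rho>"
  shows "AE \<omega> in run_measure M s0 \<sigma>. \<forall>n. P n (map \<omega> [0..<n])"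
  unfolding AE_all_countable
proof
  fix n
  have "emeasure (run_measure M s0 \<sigma>) {\<omega>. \<not> P n (map \<omega> [0..<n])} = 0"
    using assms
    by (auto simp: emeasure_run_measure_prefix[where P="\<lambda>\<rho>. \<not> P n \<rho>"] measure_pmf.emeasure_eq_measure
        measure_pmf_zero_iff)
  then show "AE \<omega> in run_measure M s0 \<sigma>. P n (map \<omega> [0..<n])"
    by (intro AE_I'[of "{\<omega>. \<not> P n (map \<omega> [0..<n])}"])
      (auto simp: null_sets_def sets_run_measure_prefix[where P="\<lambda>\<rho>. \<not> P n \<rho>"])
qed


section \<open>Partial runs of positive probability and their lifts to the chain of modes and
  states\<close>

lemma prefix_pmf_run:
  assumes "well_formed M" "strategy M \<sigma>" "\<rho> \<in> set_pmf (prefix_pmf M s0 \<sigma> n)"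
  shows "length \<rho> = n" and "\<rho> \<noteq> [] \<Longrightarrow> partial_run M \<rho> \<and> hd \<rho> = s0"
proof -
  have "length \<rho> = n \<and> (\<rho> \<noteq> [] \<longrightarrow> partial_run M \<rho> \<and> hd \<rho> = s0)"
    using assms(3)
  proof (induction n arbitrary: \<rho>)
    case (Suc n)
    then obtain \<rho>' x where \<rho>': "\<rho>' \<in> set_pmf (prefix_pmf M s0 \<sigma> n)" and \<rho>: "\<rho> = \<rho>' @ [x]"
      and x: "x \<in> set_pmf (if \<rho>' = [] then return_pmf s0 else next_state M \<sigma> \<rho>')"
      by auto
    show ?case
    proof (cases "\<rho>' = []")
      case True
      then show ?thesis
        using Suc.IH[OF \<rho>'] x \<rho> by (simp add: partial_run_def)
    next
      case False
      then have "(last \<rho>', x) \<in> transitions M"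
        using x assms(1,2) Suc.IH[OF \<rho>']
        by (auto simp: next_state_def well_formed_def strategy_def split: if_splits)
      then show ?thesis
        using False Suc.IH[OF \<rho>'] \<rho> by (auto simp: partial_run_def successively_append_iff)
    qed
  qed simp
  then show "length \<rho> = n" and "\<rho> \<noteq> [] \<Longrightarrow> partial_run M \<rho> \<and> hd \<rho> = s0"
    by auto
qed

lemma AE_transitions:
  fixes M :: "('s::countable) mdp"
  assumes "well_formed M" "strategy M \<sigma>"
  shows "AE \<omega> in run_measure M s0 \<sigma>. \<forall>n. (\<omega> n, \<omega> (Suc n)) \<in> transitions M"
proof -
  have "AE \<omega> in run_measure M s0 \<sigma>. \<forall>n. n \<noteq> 0 \<longrightarrow> partial_run M (map \<omega> [0..<n])"
    using prefix_pmf_run[OF assms] by (intro AE_run_measure_prefix) fastforce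
  then show ?thesis
  proof (rule AE_mp, intro AE_I2 impI allI)
    fix \<omega> n assume "\<forall>n. n \<noteq> 0 \<longrightarrow> partial_run M (map \<omega> [0..<n])"
    then have "partial_run M (map \<omega> [0..<Suc (Suc n)])"
      by blast
    then show "(\<omega> n, \<omega> (Suc n)) \<in> transitions M"
      by (simp add: partial_run_def successively_append_iff)
  qed
qed

lemma fst_last_chain_prefix:
  assumes "memory_function M Q \<tau>" "m0 \<in> Q" "h \<in> set_pmf (chain_prefix \<tau> m0 s0 n)"
  shows "fst (last h) \<in> Q"
  using assms(3)
proof (induction n arbitrary: h)
  case (Suc n)
  then show ?case
    using assms(1) by (fastforce simp: memory_function_def)
qed (use assms in simp)

lemma last_lifts: "h \<in> lifts \<rho> \<Longrightarrow> \<rho> \<noteq> [] \<Longrightarrow> snd (last h) = last \<rho>"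
  by (cases "h = []") (auto simp: lifts_def last_map)

text \<open>\<open>implemented_by\<close> constrains \<open>\<sigma>\<close> only at partial runs of
  positive probability in the memory chain. Every partial run reachable under
  \<open>\<sigma>\<close> is of this kind, so the constraint is available wherever it is
  applied.\<close>

lemma chain_prefix_lifts:
  assumes "implemented_by M s0 \<sigma> Q \<tau> m0" "\<rho> \<in> set_pmf (prefix_pmf M s0 \<sigma> n)" "\<rho> \<noteq> []"
  shows "set_pmf (chain_prefix \<tau> m0 s0 (length \<rho> - 1)) \<inter> lifts \<rho> \<noteq> {}"
  using assms(2,3)
proof (induction n arbitrary: \<rho>)
  case (Suc n)
  then obtain \<rho>' x where \<rho>': "\<rho>' \<in> set_pmf (prefix_pmf M s0 \<sigma> n)" and \<rho>: "\<rho> = \<rho>' @ [x]"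
    and x: "x \<in> set_pmf (if \<rho>' = [] then return_pmf s0 else next_state M \<sigma> \<rho>')"
    by auto
  have \<tau>: "memory_function M Q \<tau>" and "m0 \<in> Q"
    and \<sigma>: "last \<rho>' \<in> controlled M \<Longrightarrow>
      set_pmf (chain_prefix \<tau> m0 s0 (length \<rho>' - 1)) \<inter> lifts \<rho>' \<noteq> {} \<Longrightarrow>
      \<sigma> \<rho>' = induced_choice \<tau> m0 s0 \<rho>'"
    using assms(1) by (auto simp: implemented_by_def)
  show ?case
  proof (cases "\<rho>' = []")
    case True
    then show ?thesis
      using x \<rho> by (simp add: lifts_def)
  next
    case False
    let ?C = "chain_prefix \<tau> m0 s0 (length \<rho>' - 1)"
    have IH: "set_pmf ?C \<inter> lifts \<rho>' \<noteq> {}"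
      using Suc.IH[OF \<rho>' False] .
    \<comment> \<open>At a controlled state, the support of the mixture is the union of the supports
      over the lifted histories. At a random state every mode has the fixed marginal, so any lift
      serves.\<close>
    have "\<exists>h\<in>set_pmf ?C \<inter> lifts \<rho>'. x \<in> snd ` set_pmf (\<tau> (fst (last h)) (last \<rho>'))"
    proof (cases "last \<rho>' \<in> controlled M")
      case True
      with x False \<sigma>[OF True IH] have "x \<in> set_pmf (induced_choice \<tau> m0 s0 \<rho>')"
        by (simp add: next_state_def)
      then show ?thesis
        using IH by (auto simp: induced_choice_def mode_dist_def)
    next
      case random: False
      obtain h where h: "h \<in> set_pmf ?C \<inter> lifts \<rho>'"
        using IH by auto
      with fst_last_chain_prefix[OF \<tau> \<open>m0 \<in> Q\<close>, of h] random \<tau>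
      have "map_pmf snd (\<tau> (fst (last h)) (last \<rho>')) = trans_prob M (last \<rho>')"
        by (auto simp: memory_function_def)
      then have "x \<in> set_pmf (map_pmf snd (\<tau> (fst (last h)) (last \<rho>')))"
        using x False random by (simp add: next_state_def)
      with h show ?thesis
        by auto
    qed
    then obtain h m where h: "h \<in> set_pmf ?C" "map snd h = \<rho>'"
      and m: "(m, x) \<in> set_pmf (\<tau> (fst (last h)) (last \<rho>'))"
      by (auto simp: lifts_def)
    then have "snd (last h) = last \<rho>'"
      using last_lifts[of h \<rho>'] False by (simp add: lifts_def)
    \<comment> \<open>Since \<open>\<rho>'\<close> is nonempty,
      \<open>Suc (length \<rho>' - 1)\<close> is \<open>length \<rho> - 1\<close>, the number of
      transitions of \<open>\<rho>\<close>.\<close>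
    with h(1) m have "h @ [(m, x)] \<in> set_pmf (chain_prefix \<tau> m0 s0 (Suc (length \<rho>' - 1)))"
      by (force simp del: One_nat_def)
    then have "h @ [(m, x)] \<in> set_pmf (chain_prefix \<tau> m0 s0 (length \<rho> - 1)) \<inter> lifts \<rho>"
      using False h(2) \<rho> by (auto simp: lifts_def)
    then show ?thesis
      by blast
  qed
qed simp

section \<open>Visiting a state infinitely often\<close>

text \<open>The conditional probability, given the partial run \<open>\<rho>\<close>, that the next
  \<open>k\<close> states all differ from \<open>v\<close>; the states of \<open>\<rho>\<close>
  itself are not tested.\<close>

primrec avoid_prob :: "'s mdp \<Rightarrow> ('s list \<Rightarrow> 's pmf) \<Rightarrow> 's \<Rightarrow> nat \<Rightarrow> 's list \<Rightarrow> ennreal" where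
  "avoid_prob M \<sigma> v 0 \<rho> = 1"
| "avoid_prob M \<sigma> v (Suc k) \<rho> =
     (\<integral>\<^sup>+x. (if x = v then 0 else avoid_prob M \<sigma> v k (\<rho> @ [x])) \<partial>next_state M \<sigma> \<rho>)"

lemma nn_integral_pmf_le:
  assumes "\<And>x. x \<in> set_pmf p \<Longrightarrow> f x \<le> (c :: ennreal)"
  shows "(\<integral>\<^sup>+x. f x \<partial>measure_pmf p) \<le> c"
proof -
  have "(\<integral>\<^sup>+x. f x \<partial>measure_pmf p) \<le> (\<integral>\<^sup>+x. c \<partial>measure_pmf p)"
    by (intro nn_integral_mono_AE) (simp add: AE_measure_pmf_iff assms)
  then show ?thesis
    by (simp add: measure_pmf.emeasure_space_1[simplified])
qed

lemma avoid_prob_antimono: "avoid_prob M \<sigma> v (Suc k) \<rho> \<le> avoid_prob M \<sigma> v k \<rho>"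
proof (induction k arbitrary: \<rho>)
  case 0
  then show ?case
    by (auto intro!: nn_integral_pmf_le)
next
  case (Suc k)
  show ?case
    by (subst (1 2) avoid_prob.simps(2)) (intro nn_integral_mono, use Suc in auto)
qed

text \<open>This is conditioning on the first \<open>n\<close> states. As \<open>avoid_prob\<close>
  unfolds the nearest state first, the induction moves the splitting time from \<open>n\<close> to
  \<open>Suc n\<close>.\<close>

lemma emeasure_prefix_pmf_avoid:
  assumes "well_formed M" "strategy M \<sigma>" "N \<le> n" "0 < n"
  shows "emeasure (prefix_pmf M s0 \<sigma> (n + k)) {\<rho>. \<forall>j\<in>{N..<length \<rho>}. \<rho> ! j \<noteq> v} =
    (\<integral>\<^sup>+\<rho>. indicator {\<rho>. \<forall>j\<in>{N..<length \<rho>}. \<rho> ! j \<noteq> v} \<rho> * avoid_prob M \<sigma> v k \<rho>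
      \<partial>prefix_pmf M s0 \<sigma> n)"
  using assms(3,4)
proof (induction k arbitrary: n)
  case (Suc k)
  let ?G = "{\<rho>. \<forall>j\<in>{N..<length \<rho>}. \<rho> ! j \<noteq> v}"
  have "emeasure (prefix_pmf M s0 \<sigma> (n + Suc k)) ?G =
      (\<integral>\<^sup>+\<rho>. indicator ?G \<rho> * avoid_prob M \<sigma> v k \<rho> \<partial>prefix_pmf M s0 \<sigma> (Suc n))"
    using Suc.IH[of "Suc n"] Suc.prems by (simp del: prefix_pmf.simps)
  also have "\<dots> = (\<integral>\<^sup>+\<rho>. \<integral>\<^sup>+x. indicator ?G (\<rho> @ [x]) * avoid_prob M \<sigma> v k (\<rho> @ [x])
      \<partial>(if \<rho> = [] then return_pmf s0 else next_state M \<sigma> \<rho>) \<partial>prefix_pmf M s0 \<sigma> n)"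
    by simp
  also have "\<dots> = (\<integral>\<^sup>+\<rho>. indicator ?G \<rho> * avoid_prob M \<sigma> v (Suc k) \<rho> \<partial>prefix_pmf M s0 \<sigma> n)"
  proof (intro nn_integral_cong_AE, unfold AE_measure_pmf_iff, intro ballI)
    fix \<rho> assume "\<rho> \<in> set_pmf (prefix_pmf M s0 \<sigma> n)"
    then have len: "length \<rho> = n" and "\<rho> \<noteq> []"
      using prefix_pmf_run(1)[OF assms(1,2)] Suc.prems by fastforce+
    have "indicator ?G (\<rho> @ [x]) * avoid_prob M \<sigma> v k (\<rho> @ [x]) =
        indicator ?G \<rho> * (if x = v then 0 else avoid_prob M \<sigma> v k (\<rho> @ [x]))" for x
    proof -
      \<comment> \<open>The appended state has index \<open>n\<close>, which is tested because
        \<open>N \<le> n\<close>.\<close>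
      have "\<rho> @ [x] \<in> ?G \<longleftrightarrow> \<rho> \<in> ?G \<and> x \<noteq> v"
        using len Suc.prems by (auto simp: nth_append atLeastLessThanSuc)
      then show ?thesis
        by (simp add: indicator_def)
    qed
    then show "(\<integral>\<^sup>+x. indicator ?G (\<rho> @ [x]) * avoid_prob M \<sigma> v k (\<rho> @ [x])
        \<partial>(if \<rho> = [] then return_pmf s0 else next_state M \<sigma> \<rho>)) =
        indicator ?G \<rho> * avoid_prob M \<sigma> v (Suc k) \<rho>"
      using \<open>\<rho> \<noteq> []\<close> by (simp add: nn_integral_cmult)
  qed
  finally show ?case .
qed simp

text \<open>The bound is uniform over reachable partial runs, so each further block of
  \<open>k\<close> states misses \<open>v\<close> with conditional probability at most
  \<open>c\<close>. Avoiding \<open>v\<close> from time \<open>N\<close> on thus has probability at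
  most \<open>c ^ i\<close> for every \<open>i\<close>.\<close>

lemma AE_infinitely_often:
  fixes M :: "('s::countable) mdp"
  assumes wf: "well_formed M" "strategy M \<sigma>" and "c < 1"
    and c: "\<And>n \<rho>. \<rho> \<in> set_pmf (prefix_pmf M s0 \<sigma> n) \<Longrightarrow> \<rho> \<noteq> [] \<Longrightarrow> avoid_prob M \<sigma> v k \<rho> \<le> c"
  shows "AE \<omega> in run_measure M s0 \<sigma>. \<exists>\<^sub>\<infinity>j. \<omega> j = v"
proof -
  have null: "emeasure (run_measure M s0 \<sigma>) {\<omega>. \<forall>j\<ge>N. \<omega> j \<noteq> v} = 0" for N
  proof -
    let ?a = "\<lambda>n. emeasure (prefix_pmf M s0 \<sigma> n) {\<rho>. \<forall>j\<in>{N..<length \<rho>}. \<rho> ! j \<noteq> v}"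
    have step: "?a (n + k) \<le> c * ?a n" if "N \<le> n" "0 < n" for n
    proof -
      have "?a (n + k) \<le> (\<integral>\<^sup>+\<rho>. c * indicator {\<rho>. \<forall>j\<in>{N..<length \<rho>}. \<rho> ! j \<noteq> v} \<rho>
          \<partial>prefix_pmf M s0 \<sigma> n)"
        unfolding emeasure_prefix_pmf_avoid[OF wf that]
      proof (intro nn_integral_mono_AE, unfold AE_measure_pmf_iff, intro ballI)
        fix \<rho> assume \<rho>: "\<rho> \<in> set_pmf (prefix_pmf M s0 \<sigma> n)"
        then have "\<rho> \<noteq> []"
          using prefix_pmf_run(1)[OF wf \<rho>] that by auto
        from c[OF \<rho> this] show "indicator {\<rho>. \<forall>j\<in>{N..<length \<rho>}. \<rho> ! j \<noteq> v} \<rho> *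
            avoid_prob M \<sigma> v k \<rho> \<le> c * indicator {\<rho>. \<forall>j\<in>{N..<length \<rho>}. \<rho> ! j \<noteq> v} \<rho>"
          by (simp add: indicator_def)
      qed
      then show ?thesis
        by (simp add: nn_integral_cmult)
    qed
    \<comment> \<open>Starting with \<open>Suc N\<close> states meets both side conditions of
      \<open>step\<close>, including that the prefix is nonempty.\<close>
    have pow: "?a (Suc N + i * k) \<le> c ^ i" for i
    proof (induction i)
      case 0
      show ?case
        by (simp add: measure_pmf.emeasure_le_1 del: prefix_pmf.simps)
    next
      case (Suc i)
      have "?a (Suc N + Suc i * k) = ?a ((Suc N + i * k) + k)"
        by (simp add: algebra_simps)
      also have "\<dots> \<le> c * ?a (Suc N + i * k)"
        by (rule step) auto
      also have "\<dots> \<le> c * c ^ i"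
        by (rule mult_left_mono[OF Suc]) simp
      finally show ?case
        by simp
    qed
    have le: "emeasure (run_measure M s0 \<sigma>) {\<omega>. \<forall>j\<ge>N. \<omega> j \<noteq> v} \<le> c ^ i" for i
    proof -
      let ?n = "Suc N + i * k"
      have "emeasure (run_measure M s0 \<sigma>) {\<omega>. \<forall>j\<ge>N. \<omega> j \<noteq> v} \<le>
          emeasure (run_measure M s0 \<sigma>)
            {\<omega>. \<forall>j\<in>{N..<length (map \<omega> [0..<?n])}. map \<omega> [0..<?n] ! j \<noteq> v}"
        by (intro emeasure_mono sets_run_measure_prefix) (auto simp del: upt_Suc)
      also have "\<dots> = ?a ?n"
        by (rule emeasure_run_measure_prefix)
      finally show ?thesis
        using pow[of i] by (rule order_trans)
    qed
    obtain r where r: "c = ennreal r" "0 \<le> r" "r < 1"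
      using \<open>c < 1\<close> by (cases c) (auto simp: ennreal_less_one_iff)
    have "(\<lambda>i. c ^ i) \<longlonglongrightarrow> ennreal 0"
      unfolding r(1) ennreal_power[OF r(2)] by (intro tendsto_ennrealI LIMSEQ_realpow_zero r)
    then have "emeasure (run_measure M s0 \<sigma>) {\<omega>. \<forall>j\<ge>N. \<omega> j \<noteq> v} \<le> ennreal 0"
      by (rule LIMSEQ_le_const) (use le in auto)
    then show ?thesis
      by simp
  qed
  have "AE \<omega> in run_measure M s0 \<sigma>. \<forall>N. \<not> (\<forall>j\<ge>N. \<omega> j \<noteq> v)"
    unfolding AE_all_countable
  proof
    fix N
    have "{\<omega>. \<forall>j\<ge>N. \<omega> j \<noteq> v} = (\<Inter>j\<in>{N..}. {\<omega>. map \<omega> [0..<Suc j] ! j \<noteq> v})"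
      by (auto simp del: upt_Suc)
    also have "\<dots> \<in> sets (run_measure M s0 \<sigma>)"
      by (intro sets.countable_INT' sets_run_measure_prefix image_subsetI) auto
    finally show "AE \<omega> in run_measure M s0 \<sigma>. \<not> (\<forall>j\<ge>N. \<omega> j \<noteq> v)"
      using null[of N] by (intro AE_I'[of "{\<omega>. \<forall>j\<ge>N. \<omega> j \<noteq> v}"]) (auto simp: null_sets_def)
  qed
  then show ?thesis
    by (simp add: INFM_nat_le)
qed


section \<open>The infinitely branching MDP\<close>

lemma transitions_inf_branching_mdp:
  "(St_s, v) \<in> transitions inf_branching_mdp \<longleftrightarrow> (\<exists>i. v = St_r i)"
  "(St_t, v) \<in> transitions inf_branching_mdp \<longleftrightarrow> v = St_s"
  "(St_r i, v) \<in> transitions inf_branching_mdp \<longleftrightarrow> v = St_s \<or> v = St_t"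
  by (auto simp: inf_branching_mdp_def)

lemma controlled_inf_branching_mdp: "controlled inf_branching_mdp = {St_s, St_t}"
  by (simp add: inf_branching_mdp_def)

text \<open>The reward of a transition is the increment of the potential that is -1 at
  \<open>St_t\<close> and 0 elsewhere, so the sum telescopes.\<close>

lemma total_reward_inf_branching_mdp:
  assumes "partial_run inf_branching_mdp \<rho>" "hd \<rho> = St_s"
  shows "total_reward inf_branching_mdp \<rho> = (if last \<rho> = St_t then - 1 else 0)"
  using assms
proof (induction \<rho> rule: rev_induct)
  case (snoc x \<rho>)
  show ?case
  proof (cases "\<rho> = []")
    case True
    then show ?thesis
      using snoc.prems by (simp add: total_reward_def)
  next
    case False
    then obtain n where n: "length \<rho> = Suc n"
      by (cases \<rho>) auto
    then have "last \<rho> = \<rho> ! n"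
      using False by (simp add: last_conv_nth)
    then have "total_reward inf_branching_mdp (\<rho> @ [x]) =
        total_reward inf_branching_mdp \<rho> + reward inf_branching_mdp (last \<rho>, x)"
      using n by (simp add: total_reward_def nth_append)
    moreover have "partial_run inf_branching_mdp \<rho>" "hd \<rho> = St_s"
      and "(last \<rho>, x) \<in> transitions inf_branching_mdp"
      using False snoc.prems by (auto simp: partial_run_def successively_append_iff)
    ultimately show ?thesis
      using snoc.IH by (auto simp: inf_branching_mdp_def)
  qed
qed (simp add: partial_run_def)

text \<open>The only negative reward is -1, collected exactly on entering \<open>St_t\<close>, so
  the liminf is nonnegative iff this happens finitely often. By \<open>AE_transitions\<close> the
  hypothesis holds for almost every run.\<close>

lemma PP_liminf_inf_branching_mdp:
  assumes "\<And>n. (\<omega> n, \<omega> (Suc n)) \<in> transitions inf_branching_mdp"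
  shows "\<omega> \<in> PP_liminf_ge_0 inf_branching_mdp \<longleftrightarrow> \<not> (\<exists>\<^sub>\<infinity>j. \<omega> j = St_t)"
proof -
  let ?r = "\<lambda>n. reward inf_branching_mdp (\<omega> n, \<omega> (Suc n))"
  have r: "\<omega> (Suc n) = St_t \<Longrightarrow> ?r n = - 1" "\<omega> (Suc n) \<noteq> St_t \<Longrightarrow> 0 \<le> ?r n" for n
    using assms[of n] by (auto simp: inf_branching_mdp_def)
  have "\<omega> \<in> PP_liminf_ge_0 inf_branching_mdp \<longleftrightarrow> (\<forall>\<^sub>F n in sequentially. \<omega> (Suc n) \<noteq> St_t)"
  proof
    assume "\<omega> \<in> PP_liminf_ge_0 inf_branching_mdp"
    then have "ereal (- 1) < liminf (\<lambda>n. ereal (?r n))"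
      by (auto simp: PP_liminf_ge_0_def intro: less_le_trans[of _ 0])
    from less_LiminfD[OF this] show "\<forall>\<^sub>F n in sequentially. \<omega> (Suc n) \<noteq> St_t"
      by (rule eventually_mono) (auto dest: r(1))
  next
    assume "\<forall>\<^sub>F n in sequentially. \<omega> (Suc n) \<noteq> St_t"
    then have "\<forall>\<^sub>F n in sequentially. 0 \<le> ereal (?r n)"
      by (rule eventually_mono) (simp add: r(2))
    then show "\<omega> \<in> PP_liminf_ge_0 inf_branching_mdp"
      by (simp add: PP_liminf_ge_0_def Liminf_bounded)
  qed
  also have "\<dots> \<longleftrightarrow> (\<forall>\<^sub>F n in sequentially. \<omega> n \<noteq> St_t)"
    by (rule eventually_sequentially_Suc)
  also have "\<dots> \<longleftrightarrow> \<not> (\<exists>\<^sub>\<infinity>j. \<omega> j = St_t)"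
    by (simp add: not_frequently cofinite_eq_sequentially)
  finally show ?thesis .
qed

section \<open>Finitely many modes\<close>

text \<open>Only the modes occurring at \<open>St_s\<close> have to be finite in number, while
  \<open>Q\<close> may be infinite. This covers plain finite memory and finite memory with a reward
  counter alike.\<close>

lemma PP_liminf_null_if_finitely_many_modes:
  assumes \<sigma>: "strategy inf_branching_mdp \<sigma>"
    and impl: "implemented_by inf_branching_mdp St_s \<sigma> Q \<tau> m0"
    and "finite B"
    and B: "\<And>n h. h \<in> set_pmf (chain_prefix \<tau> m0 St_s n) \<Longrightarrow> snd (last h) = St_s \<Longrightarrow> fst (last h) \<in> B"
  shows "measure (run_measure inf_branching_mdp St_s \<sigma>) (PP_liminf_ge_0 inf_branching_mdp) = 0"
proof -
  let ?M = inf_branching_mdp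
  let ?avoid = "avoid_prob ?M \<sigma> St_t"
  \<comment> \<open>The probability that the random state \<open>v\<close> does not move on to
    \<open>St_t\<close>.\<close>
  define w where "w v = emeasure (trans_prob ?M v) (- {St_t})" for v
  have w_less: "w (St_r i) < 1" for i
  proof -
    have "set_pmf (trans_prob ?M (St_r i)) = {St_s, St_t}"
      using well_formed_inf_branching_mdp
      by (auto simp: well_formed_def controlled_inf_branching_mdp transitions_inf_branching_mdp)
    then have "0 < pmf (trans_prob ?M (St_r i)) St_t"
      by (simp add: pmf_positive_iff)
    then show ?thesis
      using measure_pmf.prob_compl[of "{St_t}" "trans_prob ?M (St_r i)"]
      by (simp add: w_def measure_pmf.emeasure_eq_measure ennreal_less_one_iff Compl_eq_Diff_UNIV
          measure_pmf_single)
  qed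
  have \<tau>: "memory_function ?M Q \<tau>" and "m0 \<in> Q"
    using impl by (auto simp: implemented_by_def)
  \<comment> \<open>The probability, in mode \<open>m\<close> at \<open>St_s\<close>, that the
    random move following the choice misses \<open>St_t\<close>.\<close>
  define I where "I m = (\<integral>\<^sup>+x. w (snd x) \<partial>\<tau> m St_s)" for m
  \<comment> \<open>\<open>w\<close> is below 1 at each random state but tends to 1 along them, so
    only a bound for each single mode is available: a mean of values below 1 is below 1. Uniformity
    comes from the maximum over finitely many modes.\<close>
  have I_less: "I m < 1" if "m \<in> Q" for m
  proof -
    have supp: "\<exists>i. snd x = St_r i" if "x \<in> set_pmf (\<tau> m St_s)" for x
    proof -
      have "set_pmf (\<tau> m St_s) \<subseteq> Q \<times> transitions ?M `` {St_s}"
        using \<tau> \<open>m \<in> Q\<close> by (simp add: memory_function_def)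
      with that have "(St_s, snd x) \<in> transitions ?M"
        by (cases x) auto
      then show ?thesis
        by (simp add: transitions_inf_branching_mdp)
    qed
    have lt: "w (snd x) < 1" if "x \<in> set_pmf (\<tau> m St_s)" for x
      using supp[OF that] w_less by auto
    have le: "I m \<le> 1"
      unfolding I_def using lt by (intro nn_integral_pmf_le less_imp_le)
    have "I m < (\<integral>\<^sup>+x. 1 \<partial>\<tau> m St_s)"
      unfolding I_def
    proof (rule nn_integral_less)
      show "(\<integral>\<^sup>+x. w (snd x) \<partial>\<tau> m St_s) \<noteq> \<infinity>"
        using le unfolding I_def by (metis ennreal_one_neq_top infinity_ennreal_def top.extremum_unique)
      show "AE x in \<tau> m St_s. w (snd x) \<le> 1"
        using lt by (auto simp: AE_measure_pmf_iff intro: less_imp_le)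
      show "\<not> (AE x in \<tau> m St_s. 1 \<le> w (snd x))"
        using lt set_pmf_not_empty[of "\<tau> m St_s"] by (fastforce simp: AE_measure_pmf_iff)
    qed auto
    then show ?thesis
      by simp
  qed
  \<comment> \<open>The inserted 0 keeps the set nonempty, so that \<open>Max\<close> is
    meaningful.\<close>
  define c where "c = Max (insert 0 (I ` (B \<inter> Q)))"
  have fin: "finite (insert 0 (I ` (B \<inter> Q)))"
    using \<open>finite B\<close> by simp
  have "c < 1"
    unfolding c_def using fin I_less by (subst Max_less_iff) auto
  have I_le: "I m \<le> c" if "m \<in> B" "m \<in> Q" for m
    unfolding c_def using fin that by (intro Max_ge) auto
  have wf: "well_formed ?M"
    by (rule well_formed_inf_branching_mdp)
  have next_trans: "(last \<rho>, x) \<in> transitions ?M"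
    and next_prefix: "\<rho> @ [x] \<in> set_pmf (prefix_pmf ?M St_s \<sigma> (Suc n))"
    if "\<rho> \<in> set_pmf (prefix_pmf ?M St_s \<sigma> n)" "\<rho> \<noteq> []" "x \<in> set_pmf (next_state ?M \<sigma> \<rho>)" for \<rho> n x
  proof -
    show *: "\<rho> @ [x] \<in> set_pmf (prefix_pmf ?M St_s \<sigma> (Suc n))"
      using that by auto
    show "(last \<rho>, x) \<in> transitions ?M"
      using prefix_pmf_run(2)[OF wf \<sigma> *] that by (simp add: partial_run_def successively_append_iff)
  qed
  \<comment> \<open>From \<open>St_s\<close> two transitions can reach \<open>St_t\<close>: the
    choice of a random state and its random move.\<close>
  have avoid2: "?avoid 2 \<rho> \<le> c"
    if \<rho>: "\<rho> \<in> set_pmf (prefix_pmf ?M St_s \<sigma> n)" "\<rho> \<noteq> []" and last: "last \<rho> = St_s" for \<rho> n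
  proof -
    have lifts: "set_pmf (chain_prefix \<tau> m0 St_s (length \<rho> - 1)) \<inter> lifts \<rho> \<noteq> {}"
      by (rule chain_prefix_lifts[OF impl \<rho>])
    have mode: "m \<in> B" "m \<in> Q" if "m \<in> set_pmf (mode_dist \<tau> m0 St_s \<rho>)" for m
    proof -
      from that obtain h where h: "h \<in> set_pmf (chain_prefix \<tau> m0 St_s (length \<rho> - 1))"
        "h \<in> lifts \<rho>" "m = fst (last h)"
        using lifts by (auto simp: mode_dist_def)
      then have "snd (last h) = St_s"
        using last \<rho>(2) last_lifts by metis
      then show "m \<in> B" "m \<in> Q"
        using B h fst_last_chain_prefix[OF \<tau> \<open>m0 \<in> Q\<close>] by auto
    qed
    have "?avoid 2 \<rho> = (\<integral>\<^sup>+x. (if x = St_t then 0 else ?avoid (Suc 0) (\<rho> @ [x])) \<partial>next_state ?M \<sigma> \<rho>)"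
      by (simp add: numeral_2_eq_2)
    also have "\<dots> \<le> (\<integral>\<^sup>+x. w x \<partial>next_state ?M \<sigma> \<rho>)"
    proof (intro nn_integral_mono_AE, unfold AE_measure_pmf_iff, intro ballI)
      fix x assume "x \<in> set_pmf (next_state ?M \<sigma> \<rho>)"
      with next_trans[OF \<rho>] last obtain i where x: "x = St_r i"
        by (auto simp: transitions_inf_branching_mdp)
      then have "next_state ?M \<sigma> (\<rho> @ [x]) = trans_prob ?M x"
        by (simp add: next_state_def controlled_inf_branching_mdp)
      then have "?avoid (Suc 0) (\<rho> @ [x]) = (\<integral>\<^sup>+y. indicator (- {St_t}) y \<partial>trans_prob ?M x)"
        unfolding avoid_prob.simps by (simp only:) (rule nn_integral_cong, simp split: split_indicator)
      then show "(if x = St_t then 0 else ?avoid (Suc 0) (\<rho> @ [x])) \<le> w x"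
        by (simp add: w_def x del: avoid_prob.simps)
    qed
    also have "next_state ?M \<sigma> \<rho> = induced_choice \<tau> m0 St_s \<rho>"
      using impl lifts last
      by (simp add: next_state_def controlled_inf_branching_mdp implemented_by_def)
    \<comment> \<open>The observed choice is a mixture of the choices of the modes, so a bound
      common to the modes carries over.\<close>
    also have "(\<integral>\<^sup>+x. w x \<partial>induced_choice \<tau> m0 St_s \<rho>) = (\<integral>\<^sup>+m. I m \<partial>mode_dist \<tau> m0 St_s \<rho>)"
      by (simp add: induced_choice_def I_def last)
    also have "\<dots> \<le> c"
      using mode I_le by (intro nn_integral_pmf_le) auto
    finally show ?thesis .
  qed
  \<comment> \<open>From a random state or \<open>St_t\<close>, one transition leads to
    \<open>St_t\<close> or to \<open>St_s\<close>, where \<open>avoid2\<close> applies. Three steps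
    therefore give a bound valid at every reachable partial run.\<close>
  have avoid3: "?avoid 3 \<rho> \<le> c" if \<rho>: "\<rho> \<in> set_pmf (prefix_pmf ?M St_s \<sigma> n)" "\<rho> \<noteq> []" for \<rho> n
  proof (cases "last \<rho> = St_s")
    case True
    have "?avoid 3 \<rho> \<le> ?avoid 2 \<rho>"
      using avoid_prob_antimono[of ?M \<sigma> St_t 2 \<rho>] by (simp del: avoid_prob.simps)
    also have "\<dots> \<le> c"
      using avoid2[OF \<rho> True] .
    finally show ?thesis .
  next
    case False
    have "?avoid 3 \<rho> = (\<integral>\<^sup>+x. (if x = St_t then 0 else ?avoid 2 (\<rho> @ [x])) \<partial>next_state ?M \<sigma> \<rho>)"
      by (simp only: numeral_3_eq_3 numeral_2_eq_2 avoid_prob.simps(2))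
    also have "\<dots> \<le> c"
    proof (intro nn_integral_pmf_le)
      fix x assume x: "x \<in> set_pmf (next_state ?M \<sigma> \<rho>)"
      have "x = St_s \<or> x = St_t"
        using next_trans[OF \<rho> x] False by (cases "last \<rho>") (auto simp: transitions_inf_branching_mdp)
      then show "(if x = St_t then 0 else ?avoid 2 (\<rho> @ [x])) \<le> c"
        using avoid2[OF next_prefix[OF \<rho> x]] by auto
    qed
    finally show ?thesis .
  qed
  have "AE \<omega> in run_measure ?M St_s \<sigma>. \<exists>\<^sub>\<infinity>j. \<omega> j = St_t"
    by (rule AE_infinitely_often[OF wf \<sigma> \<open>c < 1\<close> avoid3])
  then have "AE \<omega> in run_measure ?M St_s \<sigma>. \<omega> \<notin> PP_liminf_ge_0 ?M"
    using AE_transitions[OF wf \<sigma>]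
    by eventually_elim (simp add: PP_liminf_inf_branching_mdp)
  then show ?thesis
    by (rule prob_space.prob_eq_0[OF prob_space_run_measure PP_liminf_ge_0_in_sets, THEN iffD2])
qed

lemma FR_strategy_PP_liminf_null:
  assumes "FR_strategy inf_branching_mdp St_s \<sigma>"
  shows "measure (run_measure inf_branching_mdp St_s \<sigma>) (PP_liminf_ge_0 inf_branching_mdp) = 0"
proof -
  from assms obtain Q :: "nat set" and \<tau> q0 where "strategy inf_branching_mdp \<sigma>" "finite Q"
    and impl: "implemented_by inf_branching_mdp St_s \<sigma> Q \<tau> q0"
    by (auto simp: FR_strategy_def)
  moreover have "memory_function inf_branching_mdp Q \<tau>" "q0 \<in> Q"
    using impl by (auto simp: implemented_by_def)
  \<comment> \<open>Here the finite set of modes at \<open>St_s\<close> is taken to be all of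
    \<open>Q\<close>.\<close>
  ultimately show ?thesis
    by (intro PP_liminf_null_if_finitely_many_modes fst_last_chain_prefix)
qed

text \<open>The set \<open>Q \<times> UNIV\<close> is infinite, but at \<open>St_s\<close> the
  counter equals 0, so only the finitely many modes in \<open>Q \<times> {0}\<close> occur
  there.\<close>

lemma reward_counter_FR_strategy_PP_liminf_null:
  assumes "reward_counter_FR_strategy inf_branching_mdp St_s \<sigma>"
  shows "measure (run_measure inf_branching_mdp St_s \<sigma>) (PP_liminf_ge_0 inf_branching_mdp) = 0"
proof -
  from assms obtain Q :: "nat set" and \<tau> q0 where \<sigma>: "strategy inf_branching_mdp \<sigma>" and "finite Q"
    and counts: "counts_reward inf_branching_mdp Q \<tau>"
    and impl: "implemented_by inf_branching_mdp St_s \<sigma> (Q \<times> UNIV) \<tau> (q0, 0)"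
    by (auto simp: reward_counter_FR_strategy_def)
  have \<tau>: "memory_function inf_branching_mdp (Q \<times> UNIV) \<tau>" and q0: "(q0, 0) \<in> Q \<times> UNIV"
    using impl by (auto simp: implemented_by_def)
  \<comment> \<open>The counter follows the same potential as the total reward, by induction along
    the memory chain.\<close>
  have counter: "snd (fst (last h)) = (if snd (last h) = St_t then - 1 else 0)"
    if "h \<in> set_pmf (chain_prefix \<tau> (q0, 0) St_s n)" for h n
    using that
  proof (induction n arbitrary: h)
    case (Suc n)
    then obtain h' x where h': "h' \<in> set_pmf (chain_prefix \<tau> (q0, 0) St_s n)" and h: "h = h' @ [x]"
      and x: "x \<in> set_pmf (\<tau> (fst (last h')) (snd (last h')))"
      by auto
    obtain q c v where last: "last h' = ((q, c), v)"
      by (metis surj_pair)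
    obtain q' c' v' where x': "x = ((q', c'), v')"
      by (metis surj_pair)
    have "q \<in> Q"
      using fst_last_chain_prefix[OF \<tau> q0 h'] last by simp
    then have "c' = c + reward inf_branching_mdp (v, v')" "(v, v') \<in> transitions inf_branching_mdp"
      using x x' last counts \<tau> by (fastforce simp: counts_reward_def memory_function_def)+
    then show ?case
      using Suc.IH[OF h'] last x' h by (auto simp: inf_branching_mdp_def)
  qed simp
  show ?thesis
  proof (rule PP_liminf_null_if_finitely_many_modes[OF \<sigma> impl])
    show "finite (Q \<times> {0 :: real})"
      using \<open>finite Q\<close> by simp
    fix n h assume "h \<in> set_pmf (chain_prefix \<tau> (q0, 0) St_s n)" "snd (last h) = St_s"
    then show "fst (last h) \<in> Q \<times> {0}"
      using counter fst_last_chain_prefix[OF \<tau> q0] by (auto simp: mem_Times_iff)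
  qed
qed

section \<open>An almost surely winning strategy\<close>

text \<open>The length of the partial run acts as a step counter: later visits to
  \<open>St_s\<close> choose random states with geometrically smaller probabilities of moving to
  \<open>St_t\<close>.\<close>

definition escalating_strategy :: "vertex list \<Rightarrow> vertex pmf" where
  "escalating_strategy \<rho> = return_pmf (if last \<rho> = St_t then St_s else St_r (length \<rho>))"

lemma HD_escalating_strategy: "HD_strategy inf_branching_mdp escalating_strategy"
  by (auto simp: HD_strategy_def strategy_def escalating_strategy_def controlled_inf_branching_mdp
      transitions_inf_branching_mdp)

text \<open>
  Since \<open>St_r i\<close> stands for \<open>r\<^sub>i\<^sub>+\<^sub>1\<close>, it moves to \<open>t\<close> with probability \<open>2\<^sup>-\<^sup>n\<close> for this \<open>n\<close>.
\<close>

lemma escalating_strategy_index: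
  assumes "\<rho> \<in> set_pmf (prefix_pmf inf_branching_mdp St_s escalating_strategy n)" "\<rho> \<noteq> []"
    and "last \<rho> = St_r i"
  shows "n = Suc i"
proof -
  have wf: "well_formed inf_branching_mdp" and \<sigma>: "strategy inf_branching_mdp escalating_strategy"
    using well_formed_inf_branching_mdp HD_escalating_strategy by (auto simp: HD_strategy_def)
  have "n = length \<rho>"
    using prefix_pmf_run(1)[OF wf \<sigma> assms(1)] by simp
  with assms(2) obtain m where n: "n = Suc m"
    by (cases \<rho>) auto
  with assms(1) obtain \<rho>' x
    where \<rho>': "\<rho>' \<in> set_pmf (prefix_pmf inf_branching_mdp St_s escalating_strategy m)"
      and "\<rho> = \<rho>' @ [x]" and "x \<in> set_pmf (if \<rho>' = [] then return_pmf St_s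
        else next_state inf_branching_mdp escalating_strategy \<rho>')"
    by auto
  with assms(3) have "\<rho>' \<noteq> []" "St_r i \<in> set_pmf (next_state inf_branching_mdp escalating_strategy \<rho>')"
    by (auto split: if_splits)
  then have "i = length \<rho>'"
    by (cases "last \<rho>'") (auto simp: next_state_def escalating_strategy_def inf_branching_mdp_def split: if_splits)
  then show ?thesis
    using prefix_pmf_run(1)[OF wf \<sigma> \<rho>'] n by simp
qed

text \<open>The state at time \<open>n\<close> is \<open>St_t\<close> with probability at most
  \<open>(1 / 2) ^ n\<close>. These bounds are summable, so by Borel-Cantelli almost every run
  visits \<open>St_t\<close> finitely often.\<close>

lemma escalating_strategy_wins:
  "measure (run_measure inf_branching_mdp St_s escalating_strategy)
     (PP_liminf_ge_0 inf_branching_mdp) = 1"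
proof -
  let ?M = inf_branching_mdp and ?\<sigma> = escalating_strategy
  let ?R = "run_measure ?M St_s ?\<sigma>"
  have wf: "well_formed ?M" and \<sigma>: "strategy ?M ?\<sigma>"
    using well_formed_inf_branching_mdp HD_escalating_strategy by (auto simp: HD_strategy_def)
  have eq: "{\<omega>. \<omega> n = St_t} = {\<omega>. last (map \<omega> [0..<Suc n]) = St_t}" for n
    by simp
  have sets: "{\<omega>. \<omega> n = St_t} \<in> sets ?R" for n
    unfolding eq by (rule sets_run_measure_prefix)
  have bound: "emeasure ?R {\<omega>. \<omega> n = St_t} \<le> ennreal ((1 / 2) ^ n)" for n
  proof -
    have "emeasure ?R {\<omega>. \<omega> n = St_t} = emeasure (prefix_pmf ?M St_s ?\<sigma> (Suc n)) {\<rho>. last \<rho> = St_t}"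
      unfolding eq by (rule emeasure_run_measure_prefix)
    \<comment> \<open>A prefix of \<open>n\<close> states has indices below \<open>n\<close>, so the
      state at time \<open>n\<close> is the one appended next.\<close>
    also have "\<dots> = (\<integral>\<^sup>+\<rho>. emeasure (if \<rho> = [] then return_pmf St_s else next_state ?M ?\<sigma> \<rho>) {St_t}
        \<partial>prefix_pmf ?M St_s ?\<sigma> n)"
      by (simp add: vimage_def)
    also have "\<dots> \<le> ennreal ((1 / 2) ^ n)"
    proof (rule nn_integral_pmf_le)
      fix \<rho> assume \<rho>: "\<rho> \<in> set_pmf (prefix_pmf ?M St_s ?\<sigma> n)"
      show "emeasure (if \<rho> = [] then return_pmf St_s else next_state ?M ?\<sigma> \<rho>) {St_t}
          \<le> ennreal ((1 / 2) ^ n)"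
      proof (cases "\<exists>i. \<rho> \<noteq> [] \<and> last \<rho> = St_r i")
        case True
        then obtain i where i: "\<rho> \<noteq> []" "last \<rho> = St_r i"
          by blast
        have n: "n = Suc i"
          by (rule escalating_strategy_index[OF \<rho> i])
        have "(1 / 2 :: real) ^ Suc i \<le> 1"
          by (rule power_le_one) auto
        moreover have "(\<lambda>b. if b then St_t else St_s) -` {St_t} = {True}"
          by (auto split: if_splits)
        ultimately show ?thesis
          using i by (simp add: n next_state_def inf_branching_mdp_def emeasure_pmf_single pmf_map
              measure_pmf_single del: power_Suc)
      next
        case False
        \<comment> \<open>The initial state is \<open>St_s\<close>, and neither \<open>St_s\<close>
          nor \<open>St_t\<close> has \<open>St_t\<close> as a successor under this
          strategy.\<close>
        then have "St_t \<notin> set_pmf (if \<rho> = [] then return_pmf St_s else next_state ?M ?\<sigma> \<rho>)"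
          by (cases "last \<rho>") (auto simp: next_state_def escalating_strategy_def controlled_inf_branching_mdp)
        then show ?thesis
          by (simp add: emeasure_pmf_single set_pmf_iff del: if_split)
      qed
    qed
    finally show ?thesis .
  qed
  have "AE \<omega> in ?R. \<forall>\<^sub>F n in sequentially. \<omega> \<in> space ?R - {\<omega>. \<omega> n = St_t}"
  proof (rule borel_cantelli_AE1[OF sets])
    show "emeasure ?R {\<omega>. \<omega> n = St_t} < \<infinity>" for n
      using bound[of n] by (rule le_less_trans) simp
    show "summable (\<lambda>n. measure ?R {\<omega>. \<omega> n = St_t})"
    proof (rule summable_comparison_test'[of "\<lambda>n. (1 / 2 :: real) ^ n"])
      show "norm (measure ?R {\<omega>. \<omega> n = St_t}) \<le> (1 / 2) ^ n" for n
        using enn2real_mono[OF bound[of n]] by (simp add: measure_def)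
    qed (simp add: summable_geometric)
  qed
  then have "AE \<omega> in ?R. \<omega> \<in> PP_liminf_ge_0 ?M"
    using AE_transitions[OF wf \<sigma>]
    by eventually_elim (simp add: PP_liminf_inf_branching_mdp not_frequently cofinite_eq_sequentially
        space_run_measure)
  then show ?thesis
    by (rule prob_space.prob_eq_1[OF prob_space_run_measure PP_liminf_ge_0_in_sets, THEN iffD2])
qed

section \<open>The value from \<open>St_s\<close> and the final statement\<close>

lemma mdp_value_inf_branching_mdp:
  "mdp_value inf_branching_mdp St_s (PP_liminf_ge_0 inf_branching_mdp) = 1"
proof -
  have le: "attainment inf_branching_mdp St_s (PP_liminf_ge_0 inf_branching_mdp) \<sigma> \<le> 1" for \<sigma>
    unfolding attainment_def by (rule prob_space.prob_le_1[OF prob_space_run_measure])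
  have \<sigma>: "strategy inf_branching_mdp escalating_strategy"
    "attainment inf_branching_mdp St_s (PP_liminf_ge_0 inf_branching_mdp) escalating_strategy = 1"
    using HD_escalating_strategy escalating_strategy_wins
    by (auto simp: HD_strategy_def attainment_def)
  show ?thesis
    unfolding mdp_value_def
  proof (rule cSup_eq_maximum)
    show "1 \<in> attainment inf_branching_mdp St_s (PP_liminf_ge_0 inf_branching_mdp) `
        {\<sigma>. strategy inf_branching_mdp \<sigma>}"
      using \<sigma> by (auto intro!: image_eqI[of _ _ escalating_strategy])
  qed (use le in auto)
qed

theorem theorem3p13:
  shows "(\<forall>\<rho>. partial_run inf_branching_mdp \<rho> \<and> hd \<rho> = St_s \<longrightarrow>
            total_reward inf_branching_mdp \<rho> = (if last \<rho> = St_t then - 1 else 0))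
    \<and> (\<forall>\<sigma>. FR_strategy inf_branching_mdp St_s \<sigma> \<longrightarrow>
          measure (run_measure inf_branching_mdp St_s \<sigma>) (PP_liminf_ge_0 inf_branching_mdp) = 0)
    \<and> (\<exists>\<sigma>. HD_strategy inf_branching_mdp \<sigma> \<and>
          measure (run_measure inf_branching_mdp St_s \<sigma>) (PP_liminf_ge_0 inf_branching_mdp) = 1)
    \<and> (\<exists>\<sigma>. optimal inf_branching_mdp St_s (PP_liminf_ge_0 inf_branching_mdp) \<sigma> \<and>
          almost_surely_winning inf_branching_mdp St_s (PP_liminf_ge_0 inf_branching_mdp) \<sigma>)
    \<and> (\<forall>\<sigma>. reward_counter_FR_strategy inf_branching_mdp St_s \<sigma> \<longrightarrow>
          \<not> optimal inf_branching_mdp St_s (PP_liminf_ge_0 inf_branching_mdp) \<sigma> \<and>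
          \<not> almost_surely_winning inf_branching_mdp St_s (PP_liminf_ge_0 inf_branching_mdp) \<sigma> \<and>
          (\<forall>\<epsilon>. 0 < \<epsilon> \<and> \<epsilon> < 1 \<longrightarrow>
             \<not> eps_optimal inf_branching_mdp St_s (PP_liminf_ge_0 inf_branching_mdp) \<epsilon> \<sigma>))"
proof (intro conjI)
  have "strategy inf_branching_mdp escalating_strategy"
    using HD_escalating_strategy by (simp add: HD_strategy_def)
  then show "\<exists>\<sigma>. optimal inf_branching_mdp St_s (PP_liminf_ge_0 inf_branching_mdp) \<sigma> \<and>
      almost_surely_winning inf_branching_mdp St_s (PP_liminf_ge_0 inf_branching_mdp) \<sigma>"
    using escalating_strategy_wins mdp_value_inf_branching_mdp
    by (auto simp: optimal_def almost_surely_winning_def attainment_def)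
\<comment> \<open>The value is 1, so a strategy attaining 0 is neither optimal nor almost surely
  winning, and falls short of \<open>1 - \<epsilon>\<close> whenever
  \<open>\<epsilon> < 1\<close>.\<close>
qed (use total_reward_inf_branching_mdp FR_strategy_PP_liminf_null HD_escalating_strategy
    escalating_strategy_wins reward_counter_FR_strategy_PP_liminf_null mdp_value_inf_branching_mdp
    in \<open>auto simp: optimal_def almost_surely_winning_def eps_optimal_def attainment_def\<close>)

end
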